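(* Let $X$ be a connected oriented graph with at least two vertices, and let $a$ be a vertex. The following are equivalent: (i) the vertex $a$ is periodic; (ii) for all $r,s$ with $\theta_r,\theta_s\in\Phi_a$ and $\theta_s\neq0$, the ratio $\theta_r/\theta_s$ is rational; (iii) there exists a square-free positive integer $\Delta$ such that all eigenvalues in $\Phi_a$ lie in $\mathbb{Z}[\sqrt{-\Delta}]=\{x+y\sqrt{-\Delta}:x,y\in\mathbb{Z}\}$.
   Context: An oriented graph $X$ is a simple undirected graph in which every edge is given one of its two directions. Its adjacency matrix $A$ is indexed by $V(X)$, with $A_{a,b}=1$ if the edge $\{a,b\}$ is oriented from $a$ to $b$, $A_{a,b}=-1$ if it is oriented from $b$ to $a$, and $0$ if $a,b$ are non-adjacent. The transition matrix is $U(t)=\exp(tA)$, and $e_a$ is the standard basis vector of vertex $a$. A vertex $a$ is periodic if there is a nonzero $\sigma\in\mathbb{R}$ with $U(\sigma)e_a=\pm e_a$. Let $\theta_0,\ldots,\theta_d$ be the distinct (complex) eigenvalues of $A$ and $E_r$ the orthogonal projection of $\mathbb{C}^{V(X)}$ onto the $\theta_r$-eigenspace. The eigenvalue support of $a$ is $\Phi_a=\{\theta_r: E_re_a\neq 0\}$. *)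

theory Defs
  imports "HOL-Analysis.Analysis" "HOL-Computational_Algebra.Squarefree"
begin

text \<open>
  An oriented graph on the finite vertex type \<open>'n\<close> is given by its arc relation:
  \<open>D a b\<close> means that \<open>{a, b}\<close> is an edge and is oriented from \<open>a\<close> to \<open>b\<close>.
  Asymmetry of \<open>D\<close> says that there are no loops and that every edge carries only one direction.
  The underlying undirected adjacency relation is \<open>symclp D\<close>.
\<close>

definition oriented_graph :: "('n::finite \<Rightarrow> 'n \<Rightarrow> bool) \<Rightarrow> bool" where
  "oriented_graph D \<longleftrightarrow> (\<forall>a b. D a b \<longrightarrow> \<not> D b a)"

definition graph_connected :: "('n::finite \<Rightarrow> 'n \<Rightarrow> bool) \<Rightarrow> bool" where
  "graph_connected D \<longleftrightarrow> (\<forall>a b. (symclp D)\<^sup>*\<^sup>* a b)"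

definition adj_matrix :: "('n::finite \<Rightarrow> 'n \<Rightarrow> bool) \<Rightarrow> complex ^ 'n ^ 'n" where
  "adj_matrix D = (\<chi> a b. if D a b then 1 else if D b a then -1 else 0)"

primrec mat_power :: "complex ^ 'n ^ 'n \<Rightarrow> nat \<Rightarrow> complex ^ 'n ^ 'n::finite" where
  "mat_power A 0 = mat 1"
| "mat_power A (Suc k) = A ** mat_power A k"

text \<open>
  The constant \<open>exp\<close> of the library is not available here, since \<open>complex ^ 'n ^ 'n\<close> is not
  an instance of \<open>real_normed_algebra_1\<close> (its multiplication is componentwise).
\<close>

definition mat_exp :: "complex ^ 'n ^ 'n \<Rightarrow> complex ^ 'n ^ 'n::finite" where
  "mat_exp A = (\<Sum>k. (1 / fact k) *\<^sub>R mat_power A k)"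

definition transition_matrix :: "('n::finite \<Rightarrow> 'n \<Rightarrow> bool) \<Rightarrow> real \<Rightarrow> complex ^ 'n ^ 'n" where
  "transition_matrix D t = mat_exp (t *\<^sub>R adj_matrix D)"

definition periodic_vertex :: "('n::finite \<Rightarrow> 'n \<Rightarrow> bool) \<Rightarrow> 'n \<Rightarrow> bool" where
  "periodic_vertex D a \<longleftrightarrow>
     (\<exists>\<sigma>. \<sigma> \<noteq> 0 \<and>
        (transition_matrix D \<sigma> *v axis a 1 = axis a 1 \<or>
         transition_matrix D \<sigma> *v axis a 1 = - axis a 1))"

definition eigenspace :: "complex ^ 'n ^ 'n \<Rightarrow> complex \<Rightarrow> (complex ^ 'n::finite) set" where
  "eigenspace A \<theta> = {v. A *v v = \<theta> *s v}"

definition eigenvalues :: "complex ^ 'n ^ 'n::finite \<Rightarrow> complex set" where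
  "eigenvalues A = {\<theta>. \<exists>v. v \<noteq> 0 \<and> A *v v = \<theta> *s v}"

text \<open>
  The Hermitian inner product; the library's \<open>\<bullet>\<close> on \<open>complex ^ 'n\<close> is its real part.
\<close>

definition hermitian_inner :: "complex ^ 'n \<Rightarrow> complex ^ 'n::finite \<Rightarrow> complex" where
  "hermitian_inner u v = (\<Sum>i\<in>UNIV. u $ i * cnj (v $ i))"

text \<open>
  For a complex subspace \<open>W\<close>, the described vector exists and is unique.
\<close>

definition orthogonal_projection ::
    "(complex ^ 'n) set \<Rightarrow> complex ^ 'n \<Rightarrow> complex ^ 'n::finite" where
  "orthogonal_projection W v =
     (THE w. w \<in> W \<and> (\<forall>u\<in>W. hermitian_inner (v - w) u = 0))"

definition eigenvalue_support :: "('n::finite \<Rightarrow> 'n \<Rightarrow> bool) \<Rightarrow> 'n \<Rightarrow> complex set" where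
  "eigenvalue_support D a =
     {\<theta> \<in> eigenvalues (adj_matrix D).
        orthogonal_projection (eigenspace (adj_matrix D) \<theta>) (axis a 1) \<noteq> 0}"

definition Z_sqrt_neg :: "nat \<Rightarrow> complex set" where
  "Z_sqrt_neg \<Delta> = {of_int x + of_int y * csqrt (- of_nat \<Delta>) | x y. True}"

end

theory Submission
  imports Defs "HOL-Computational_Algebra.Fundamental_Theorem_Algebra"
begin

text \<open>
  The adjacency matrix $A$ is skew-Hermitian, so $e_a = \sum_{\theta \in \Phi_a} f_\theta$ with
  orthogonal nonzero eigenvectors $f_\theta$, and $U(t) e_a = \sum e^{t \theta} f_\theta$. Hence $a$
  is periodic iff all $e^{\sigma \theta}$ agree and are $\pm 1$ for some $\sigma \neq 0$; since the
  $\theta$ are purely imaginary, this is commensurability of $\Phi_a$.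

  For the integrality condition, Galois conjugation is replaced by a $\mathbb{Q}$-linear map
  $\pi : \mathbb{C} \to \mathbb{Q}$ with $\pi(1) = 1$. As $A$ and $e_a$ are integral, applying $\pi$
  to the coefficients of $P = \prod_{\theta \in \Phi_a} (x - \theta)$ yields another monic polynomial
  of the same degree annihilating $e_a$, so it equals $P$, and $P$ is rational. Thus
  $\sum \theta^2 = e_1^2 - 2 e_2$ is rational; if all $\theta = q_\theta \mu$ with rational
  $q_\theta$, it equals $\mu^2 \sum q_\theta^2$, so $\mu^2$ is rational. Being an eigenvalue of the
  integer matrix $A^2$, it is an integer, and $\Delta$ is the square-free part of $-\mu^2$.
\<close>

subsection \<open>Rationality and integrality\<close>

lemma exists_rational_functional:
  obtains \<pi> :: "complex \<Rightarrow> complex"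
  where "\<And>x y. \<pi> (x + y) = \<pi> x + \<pi> y" and "\<And>q z. q \<in> \<rat> \<Longrightarrow> \<pi> (q * z) = q * \<pi> z"
    and "\<And>z. \<pi> z \<in> \<rat>" and "\<pi> 1 = 1"
proof -
  interpret vector_space_pair "\<lambda>(q::rat) (z::complex). of_rat q * z" "(*) :: rat \<Rightarrow> rat \<Rightarrow> rat"
    by unfold_locales (simp_all add: algebra_simps of_rat_add of_rat_mult)
  have "vs1.independent {1}"
    by simp
  then obtain g where g: "Vector_Spaces.linear (\<lambda>q (z::complex). of_rat q * z) (*) g" "g 1 = 1"
    using linear_independent_extend[of "{1}" "\<lambda>_. 1"] by auto
  interpret Vector_Spaces.linear "\<lambda>(q::rat) (z::complex). of_rat q * z" "(*)" g by (rule g(1))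
  show thesis
  proof (rule that[of "\<lambda>z. of_rat (g z)"])
    fix q z :: complex assume "q \<in> \<rat>"
    then show "of_rat (g (q * z)) = q * of_rat (g z)"
      by cases (simp add: scale of_rat_mult)
  qed (simp_all add: add of_rat_add g(2))
qed

lemma additive_sum:
  fixes h :: "'a::ab_group_add \<Rightarrow> 'b::ab_group_add"
  assumes "\<And>x y. h (x + y) = h x + h y"
  shows "h (\<Sum>i\<in>S. f i) = (\<Sum>i\<in>S. h (f i))"
proof -
  interpret additive h by unfold_locales (rule assms)
  show ?thesis by (rule sum)
qed

lemma matrix_vector_mult_in_Ints:
  fixes B :: "'a::ring_1 ^ 'n ^ 'm"
  assumes "\<And>i j. B $ i $ j \<in> \<int>" and "\<And>i. v $ i \<in> \<int>"
  shows "(B *v v) $ i \<in> \<int>"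
  using assms by (auto simp: matrix_vector_mult_def)

lemma rational_in_Ints_if_multiples_of_powers_in_Ints:
  fixes r m :: "'a::field_char_0"
  assumes "r \<in> \<rat>" and "m \<noteq> 0" and "\<And>k. r ^ k * m \<in> \<int>"
  shows "r \<in> \<int>"
proof -
  obtain p q where pq: "q > 0" "coprime p q" "r = of_int p / of_int q"
    using assms(1) by (rule Rats_cases')
  obtain n where n: "m = of_int n" using assms(3)[of 0] by (auto elim: Ints_cases)
  have dvd: "q ^ k dvd n" for k
  proof -
    obtain l where "r ^ k * m = of_int l" using assms(3)[of k] by (auto elim: Ints_cases)
    moreover have "(of_int p :: 'a) = r * of_int q" using pq by simp
    ultimately have "(of_int (p ^ k * n) :: 'a) = of_int (l * q ^ k)"
      by (simp add: n power_mult_distrib mult.commute mult.left_commute)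
    then have "p ^ k * n = l * q ^ k" by (simp only: of_int_eq_iff)
    then have "q ^ k dvd p ^ k * n" by simp
    with pq(2) show ?thesis
      by (simp add: coprime_dvd_mult_right_iff coprime_commute)
  qed
  have "q = 1"
  proof (rule ccontr)
    assume "q \<noteq> 1"
    with pq(1) have q2: "2 \<le> q" by simp
    have "int (2 ^ nat \<bar>n\<bar>) \<le> q ^ nat \<bar>n\<bar>"
      using q2 by (simp add: power_mono)
    also have "\<dots> \<le> \<bar>n\<bar>"
      using dvd[of "nat \<bar>n\<bar>"] n assms(2) by (intro dvd_imp_le_int[THEN order_trans[OF abs_ge_self]]) auto
    finally have "2 ^ nat \<bar>n\<bar> \<le> nat \<bar>n\<bar>" by linarith
    then show False using less_exp[of "nat \<bar>n\<bar>"] by linarith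
  qed
  with pq show ?thesis by simp
qed

lemma common_denominator:
  fixes S :: "'a::field_char_0 set"
  assumes "finite S" and "S \<subseteq> \<rat>"
  obtains N :: int where "N > 0" and "\<And>q. q \<in> S \<Longrightarrow> of_int N * q \<in> \<int>"
  using assms
proof (induction S arbitrary: thesis rule: finite_induct)
  case empty
  then show ?case by (metis empty_iff zero_less_one)
next
  case (insert x S)
  then obtain N :: int where N: "N > 0" "\<And>q. q \<in> S \<Longrightarrow> of_int N * q \<in> \<int>" by auto
  from insert.prems have "x \<in> \<rat>" by simp
  then obtain a b where ab: "b > 0" "x = of_int a / of_int b" by (metis Rats_cases')
  show ?case
  proof (rule insert.prems(1)[of "b * N"])
    show "b * N > 0" using ab N by simp
    fix q assume "q \<in> insert x S"
    then show "of_int (b * N) * q \<in> \<int>"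
    proof
      assume "q = x"
      then have "of_int (b * N) * q = of_int (N * a)" using ab by (simp add: field_simps)
      then show ?thesis by (simp only: Ints_of_int)
    next
      assume "q \<in> S"
      then have "of_int b * (of_int N * q) \<in> \<int>" using N(2) by simp
      then show ?thesis by (simp add: mult.assoc)
    qed
  qed
qed

lemma rational_eigenvalue_of_integer_matrix:
  fixes B :: "complex ^ 'n ^ 'n::finite"
  assumes B: "\<And>i j. B $ i $ j \<in> \<int>" and "r \<in> \<rat>" and "v \<noteq> 0" and ev: "B *v v = r *s v"
  shows "r \<in> \<int>"
proof -
  obtain \<pi> :: "complex \<Rightarrow> complex"
    where \<pi>: "\<And>x y. \<pi> (x + y) = \<pi> x + \<pi> y" "\<And>q z. q \<in> \<rat> \<Longrightarrow> \<pi> (q * z) = q * \<pi> z"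
      "\<And>z. \<pi> z \<in> \<rat>" "\<pi> 1 = 1"
    using exists_rational_functional by blast
  obtain i where i: "v $ i \<noteq> 0" using \<open>v \<noteq> 0\<close> by (auto simp: vec_eq_iff)
  define v' where "v' = inverse (v $ i) *s v"
  have ev': "B *v v' = r *s v'"
    by (simp add: v'_def vec.scale ev mult.commute)
  define w where "w = (\<chi> j. \<pi> (v' $ j))"
  have "(B *v w) $ k = (r *s w) $ k" for k
  proof -
    have "(B *v w) $ k = (\<Sum>j\<in>UNIV. \<pi> (B $ k $ j * v' $ j))"
      using B by (simp add: matrix_vector_mult_def w_def \<pi>(2) Ints_subset_Rats[THEN subsetD])
    also have "\<dots> = \<pi> ((B *v v') $ k)"
      by (simp add: matrix_vector_mult_def additive_sum[of \<pi>, OF \<pi>(1)])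
    also have "\<dots> = (r *s w) $ k"
      using \<open>r \<in> \<rat>\<close> by (simp add: ev' w_def \<pi>(2))
    finally show ?thesis .
  qed
  then have evw: "B *v w = r *s w" by (simp add: vec_eq_iff)
  have "range (\<lambda>j. w $ j) \<subseteq> \<rat>" by (auto simp: w_def \<pi>(3))
  then obtain N :: int where N: "N > 0" "\<And>q. q \<in> range (\<lambda>j. w $ j) \<Longrightarrow> of_int N * q \<in> \<int>"
    using common_denominator[of "range (\<lambda>j. w $ j)"] by (metis finite finite_imageI)
  define u where "u = of_int N *s w"
  have evu: "B *v u = r *s u"
    by (simp add: u_def vec.scale evw mult.commute)
  have int: "r ^ k * u $ j \<in> \<int>" for k j
  proof (induction k arbitrary: j)
    case 0
    then show ?case using N(2) by (simp add: u_def)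
  next
    case (Suc k)
    have "B *v (r ^ k *s u) = r ^ Suc k *s u" by (simp add: vec.scale evu mult.commute)
    then show ?case
      using matrix_vector_mult_in_Ints[of B "r ^ k *s u" j] B Suc by simp
  qed
  have "u $ i \<noteq> 0" using N(1) i by (simp add: u_def w_def v'_def \<pi>(4))
  with \<open>r \<in> \<rat>\<close> int show ?thesis
    by (blast intro: rational_in_Ints_if_multiples_of_powers_in_Ints)
qed

subsection \<open>Polynomials in a matrix\<close>

definition poly_apply :: "complex ^ 'n ^ 'n \<Rightarrow> complex poly \<Rightarrow> complex ^ 'n \<Rightarrow> complex ^ 'n::finite" where
  "poly_apply A p v = (\<Sum>k\<le>degree p. coeff p k *s (mat_power A k *v v))"

lemma poly_apply_upto:
  assumes "degree p \<le> N"
  shows "poly_apply A p v = (\<Sum>k\<le>N. coeff p k *s (mat_power A k *v v))"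
  unfolding poly_apply_def using assms
  by (intro sum.mono_neutral_left) (auto simp: coeff_eq_0)

lemma poly_apply_0 [simp]: "poly_apply A 0 v = 0"
  by (simp add: poly_apply_def)

lemma poly_apply_add: "poly_apply A (p + q) v = poly_apply A p v + poly_apply A q v"
proof -
  let ?N = "max (degree p) (degree q)"
  have "degree (p + q) \<le> ?N" by (rule degree_add_le_max)
  then show ?thesis
    by (simp add: poly_apply_upto[of _ ?N] vec.scale_left_distrib sum.distrib)
qed

lemma poly_apply_sum: "poly_apply A (\<Sum>i\<in>S. f i) v = (\<Sum>i\<in>S. poly_apply A (f i) v)"
  by (rule additive_sum) (rule poly_apply_add)

lemma poly_apply_monom: "poly_apply A (monom c k) v = c *s (mat_power A k *v v)"
proof -
  have "poly_apply A (monom c k) v = (\<Sum>j\<le>k. coeff (monom c k) j *s (mat_power A j *v v))"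
    by (rule poly_apply_upto) (rule degree_monom_le)
  also have "\<dots> = (\<Sum>j\<le>k. if j = k then c *s (mat_power A k *v v) else 0)"
    by (rule sum.cong) auto
  finally show ?thesis by simp
qed

lemma poly_apply_smult: "poly_apply A (smult c p) v = c *s poly_apply A p v"
  by (simp add: poly_apply_upto[of _ "degree p"] vec.scale_sum_right degree_smult_le
        poly_apply_def[of A p])

lemma poly_apply_pCons: "poly_apply A (pCons c p) v = c *s v + A *v poly_apply A p v"
proof -
  have "poly_apply A (pCons c p) v = (\<Sum>k\<le>Suc (degree p). coeff (pCons c p) k *s (mat_power A k *v v))"
    by (rule poly_apply_upto) (rule degree_pCons_le)
  also have "\<dots> = c *s v + (\<Sum>k\<le>degree p. coeff p k *s (A *v (mat_power A k *v v)))"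
    by (subst sum.atMost_Suc_shift) (simp add: matrix_vector_mul_assoc)
  finally show ?thesis
    by (simp add: poly_apply_def vec.sum vec.scale)
qed

lemma poly_apply_eigenvector:
  assumes "A *v v = \<theta> *s v"
  shows "poly_apply A p v = poly p \<theta> *s v"
  by (induction p)
    (simp_all add: poly_apply_pCons vec.scale assms vec.scale_left_distrib mult.commute)

lemma poly_apply_sum_vector:
  "poly_apply A p (\<Sum>i\<in>S. f i) = (\<Sum>i\<in>S. poly_apply A p (f i))"
  unfolding poly_apply_def
  by (subst sum.swap) (simp add: vec.sum vec.scale_sum_right)

lemma exists_annihilating_poly:
  obtains p where "p \<noteq> 0" and "poly_apply A p v = 0"
proof -
  let ?f = "\<lambda>k. mat_power A k *v v"
  let ?I = "{..vec.dim (UNIV :: (complex ^ 'a) set)}"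
  show thesis
  proof (cases "inj_on ?f ?I")
    case True
    have "card (?f ` ?I) > vec.dim (?f ` ?I)"
      using card_image[OF True] vec.dim_subset[of "?f ` ?I" UNIV] by simp
    then have "vec.dependent (?f ` ?I)" by (rule vec.dependent_biggerset_general)
    then obtain u k where u: "k \<in> ?I" "u (?f k) \<noteq> 0" "(\<Sum>w\<in>?f ` ?I. u w *s w) = 0"
      by (subst (asm) vec.dependent_finite) auto
    let ?p = "\<Sum>k\<in>?I. monom (u (?f k)) k"
    have "coeff ?p k = u (?f k)"
      using u(1) by (simp add: coeff_sum if_distrib cong: if_cong)
    then have "?p \<noteq> 0" using u(2) by auto
    moreover have "poly_apply A ?p v = 0"
      using u(3) by (simp only: poly_apply_sum poly_apply_monom sum.reindex[OF True] o_def)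
    ultimately show ?thesis by (rule that)
  next
    case False
    then obtain i j where ij: "i \<noteq> j" "?f i = ?f j" by (auto simp: inj_on_def)
    let ?p = "monom 1 i + monom (-1) j :: complex poly"
    have "coeff ?p i = 1" using ij(1) by simp
    then have "?p \<noteq> 0" by (metis coeff_0 zero_neq_one)
    moreover have "poly_apply A ?p v = 0"
      using ij(2) by (simp add: poly_apply_add poly_apply_monom)
    ultimately show ?thesis by (rule that)
  qed
qed

lemma poly_apply_add_vector:
  "poly_apply A p (v + w) = poly_apply A p v + poly_apply A p w"
  by (simp add: poly_apply_def vec.add vec.scale_right_distrib sum.distrib)

lemma poly_apply_scale_vector: "poly_apply A p (c *s v) = c *s poly_apply A p v"
  by (simp add: poly_apply_def vec.scale vec.scale_sum_right mult.commute)

lemma poly_apply_matrix_vector_mult: "poly_apply A p (A *v v) = A *v poly_apply A p v"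
  by (induction p) (simp_all add: poly_apply_pCons vec.add vec.scale)

lemma poly_apply_linear_factor:
  "poly_apply A ([:-\<theta>, 1:] * p) v = poly_apply A p (A *v v - \<theta> *s v)"
proof -
  have "[:-\<theta>, 1:] * p = smult (-\<theta>) p + pCons 0 p" by simp
  then have "poly_apply A ([:-\<theta>, 1:] * p) v = A *v poly_apply A p v + (-\<theta>) *s poly_apply A p v"
    by (simp only: poly_apply_add poly_apply_smult poly_apply_pCons) simp
  also have "\<dots> = poly_apply A p (A *v v + (-\<theta>) *s v)"
    by (simp only: poly_apply_add_vector poly_apply_scale_vector poly_apply_matrix_vector_mult)
  finally show ?thesis by simp
qed

subsection \<open>Spectral decomposition of skew-Hermitian matrices\<close>

lemma hermitian_inner_add_left: "hermitian_inner (u + v) w = hermitian_inner u w + hermitian_inner v w"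
  by (simp add: hermitian_inner_def algebra_simps sum.distrib)

lemma hermitian_inner_diff_left: "hermitian_inner (u - v) w = hermitian_inner u w - hermitian_inner v w"
  by (simp add: hermitian_inner_def algebra_simps sum_subtractf)

lemma hermitian_inner_sum_left: "hermitian_inner (\<Sum>i\<in>S. f i) w = (\<Sum>i\<in>S. hermitian_inner (f i) w)"
  by (rule additive_sum) (rule hermitian_inner_add_left)

lemma hermitian_inner_scale_left: "hermitian_inner (c *s u) w = c * hermitian_inner u w"
  by (simp add: hermitian_inner_def algebra_simps sum_distrib_left)

lemma hermitian_inner_scale_right: "hermitian_inner u (c *s w) = cnj c * hermitian_inner u w"
  by (simp add: hermitian_inner_def algebra_simps sum_distrib_left)

lemma hermitian_inner_zero_left [simp]: "hermitian_inner 0 w = 0"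
  by (simp add: hermitian_inner_def)

lemma hermitian_inner_self_eq_0_iff [simp]: "hermitian_inner v v = 0 \<longleftrightarrow> v = 0"
proof -
  have "hermitian_inner v v = of_real (\<Sum>i\<in>UNIV. (cmod (v $ i))\<^sup>2)"
    by (simp add: hermitian_inner_def complex_norm_square[symmetric] del: of_real_power)
  then show ?thesis
    by (simp only: of_real_eq_0_iff) (simp add: sum_nonneg_eq_0_iff vec_eq_iff)
qed

definition skew_hermitian :: "complex ^ 'n ^ 'n::finite \<Rightarrow> bool" where
  "skew_hermitian A \<longleftrightarrow> (\<forall>i j. A $ i $ j = - cnj (A $ j $ i))"

lemma hermitian_inner_skew:
  assumes "skew_hermitian A"
  shows "hermitian_inner (A *v u) v = - hermitian_inner u (A *v v)"
proof -
  have "hermitian_inner (A *v u) v = (\<Sum>i\<in>UNIV. \<Sum>j\<in>UNIV. A $ i $ j * u $ j * cnj (v $ i))"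
    by (simp add: hermitian_inner_def matrix_vector_mult_def sum_distrib_right)
  also have "\<dots> = (\<Sum>j\<in>UNIV. \<Sum>i\<in>UNIV. A $ i $ j * u $ j * cnj (v $ i))"
    by (rule sum.swap)
  also have "\<dots> = (\<Sum>j\<in>UNIV. \<Sum>i\<in>UNIV. - (u $ j * cnj (A $ j $ i * v $ i)))"
  proof (intro sum.cong refl)
    fix i j
    have "A $ i $ j = - cnj (A $ j $ i)" using assms unfolding skew_hermitian_def by blast
    then show "A $ i $ j * u $ j * cnj (v $ i) = - (u $ j * cnj (A $ j $ i * v $ i))" by simp
  qed
  also have "\<dots> = - hermitian_inner u (A *v v)"
    by (simp add: hermitian_inner_def matrix_vector_mult_def sum_distrib_left sum_negf)
  finally show ?thesis .
qed

lemma skew_hermitian_eigenvalue: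
  assumes "skew_hermitian A" and "A *v v = \<theta> *s v" and "v \<noteq> 0"
  shows "cnj \<theta> = - \<theta>"
proof -
  have "\<theta> * hermitian_inner v v = - (cnj \<theta> * hermitian_inner v v)"
    using hermitian_inner_skew[OF assms(1), of v v]
    by (simp add: assms(2) hermitian_inner_scale_left hermitian_inner_scale_right)
  then have "(\<theta> + cnj \<theta>) * hermitian_inner v v = 0" by (simp add: algebra_simps)
  then show ?thesis using assms(3) by (simp add: add_eq_0_iff)
qed

lemma skew_hermitian_eigenvectors_orthogonal:
  assumes "skew_hermitian A" and "A *v u = \<theta> *s u" and "A *v v = \<mu> *s v" and "\<theta> \<noteq> \<mu>"
  shows "hermitian_inner u v = 0"
proof (cases "v = 0")
  case True
  then show ?thesis by (simp add: hermitian_inner_def)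
next
  case False
  have "\<theta> * hermitian_inner u v = \<mu> * hermitian_inner u v"
    using hermitian_inner_skew[OF assms(1), of u v] skew_hermitian_eigenvalue[OF assms(1,3) False]
    by (simp add: assms(2,3) hermitian_inner_scale_left hermitian_inner_scale_right)
  then show ?thesis using assms(4) by simp
qed

lemma skew_hermitian_generalized_eigenvector:
  assumes A: "skew_hermitian A" and u: "A *v w - \<theta> *s w = u" and eu: "A *v u = \<theta> *s u"
  shows "A *v w = \<theta> *s w"
proof -
  have "u = 0"
  proof (rule ccontr)
    assume "u \<noteq> 0"
    have "hermitian_inner u u = hermitian_inner (A *v w) u - \<theta> * hermitian_inner w u"
      by (subst u[symmetric]) (simp add: hermitian_inner_diff_left hermitian_inner_scale_left)
    also have "\<dots> = 0"
      using skew_hermitian_eigenvalue[OF A eu \<open>u \<noteq> 0\<close>]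
      by (simp add: hermitian_inner_skew[OF A] eu hermitian_inner_scale_right)
    finally show False using \<open>u \<noteq> 0\<close> by simp
  qed
  with u show ?thesis by simp
qed

lemma eigenvector_decomposition_if_annihilated:
  assumes A: "skew_hermitian A" and "poly_apply A (\<Prod>x\<in>#M. [:-x, 1:]) v = 0"
  shows "\<exists>f. (\<forall>\<theta>. A *v f \<theta> = \<theta> *s f \<theta>) \<and> v = (\<Sum>\<theta>\<in>set_mset M. f \<theta>)"
  using assms(2)
proof (induction M arbitrary: v)
  case empty
  then have "v = 0" by (simp add: poly_apply_def)
  then show ?case by (intro exI[of _ "\<lambda>_. 0"]) simp
next
  case (add x M)
  let ?u = "A *v v - x *s v"
  have "poly_apply A (\<Prod>x\<in>#M. [:-x, 1:]) ?u = 0"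
    using add.prems by (simp only: image_mset_add_mset prod_mset.add_mset poly_apply_linear_factor)
  then obtain g where g: "\<And>\<theta>. A *v g \<theta> = \<theta> *s g \<theta>" "?u = (\<Sum>\<theta>\<in>set_mset M. g \<theta>)"
    using add.IH by blast
  define S where "S = set_mset M - {x}"
  define h where "h \<mu> = inverse (\<mu> - x) *s g \<mu>" for \<mu>
  have h: "A *v h \<mu> = \<mu> *s h \<mu>" for \<mu>
    by (simp add: h_def vec.scale g(1) mult.commute)
  define w where "w = v - (\<Sum>\<mu>\<in>S. h \<mu>)"
  have "A *v w - x *s w = ?u - (\<Sum>\<mu>\<in>S. (\<mu> - x) *s h \<mu>)"
    by (simp add: w_def vec.diff vec.sum h vec.scale_right_diff_distrib vec.scale_left_diff_distrib
        vec.scale_sum_right sum_subtractf)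
  also have "(\<Sum>\<mu>\<in>S. (\<mu> - x) *s h \<mu>) = (\<Sum>\<mu>\<in>S. g \<mu>)"
    by (rule sum.cong) (auto simp: h_def S_def)
  also have "?u - (\<Sum>\<mu>\<in>S. g \<mu>) = (if x \<in># M then g x else 0)"
    unfolding g(2) S_def by (simp add: sum_diff1)
  finally have "A *v w = x *s w"
    by (rule skew_hermitian_generalized_eigenvector[OF A]) (simp add: g(1))
  moreover have "v = w + (\<Sum>\<mu>\<in>S. h \<mu>)" by (simp add: w_def)
  moreover have "(\<Sum>\<theta>\<in>set_mset (add_mset x M). if \<theta> = x then w else h \<theta>) = w + (\<Sum>\<mu>\<in>S. h \<mu>)"
  proof -
    have "set_mset (add_mset x M) = insert x S" by (auto simp: S_def)
    moreover have "(\<Sum>\<theta>\<in>S. if \<theta> = x then w else h \<theta>) = (\<Sum>\<mu>\<in>S. h \<mu>)"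
      by (rule sum.cong) (auto simp: S_def)
    moreover have "finite S" "x \<notin> S" by (auto simp: S_def)
    ultimately show ?thesis by simp
  qed
  ultimately show ?case using h
    by (intro exI[of _ "\<lambda>\<theta>. if \<theta> = x then w else h \<theta>"]) simp
qed

lemma skew_hermitian_eigenvector_decomposition:
  assumes "skew_hermitian A"
  obtains S f where "finite S" and "\<And>\<theta>. A *v f \<theta> = \<theta> *s f \<theta>" and "v = (\<Sum>\<theta>\<in>S. f \<theta>)"
proof -
  obtain p where p: "p \<noteq> 0" "poly_apply A p v = 0" by (rule exists_annihilating_poly)
  obtain M where M: "p = smult (lead_coeff p) (\<Prod>x\<in>#M. [:-x, 1:])"
    using alg_closed_imp_factorization[OF p(1)] by blast
  have "lead_coeff p *s poly_apply A (\<Prod>x\<in>#M. [:-x, 1:]) v = 0"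
    using p(2) by (subst (asm) M) (simp only: poly_apply_smult)
  then have "poly_apply A (\<Prod>x\<in>#M. [:-x, 1:]) v = 0" using p(1) by simp
  from eigenvector_decomposition_if_annihilated[OF assms this] that[of "set_mset M"]
  show thesis by auto
qed

lemma hermitian_inner_eigenvector_sum:
  assumes "skew_hermitian A" and "finite S" and "\<And>\<theta>. \<theta> \<in> S \<Longrightarrow> A *v f \<theta> = \<theta> *s f \<theta>"
    and "A *v u = \<mu> *s u"
  shows "hermitian_inner (\<Sum>\<theta>\<in>S. f \<theta>) u = (if \<mu> \<in> S then hermitian_inner (f \<mu>) u else 0)"
proof -
  have "hermitian_inner (\<Sum>\<theta>\<in>S. f \<theta>) u = (\<Sum>\<theta>\<in>S. if \<theta> = \<mu> then hermitian_inner (f \<mu>) u else 0)"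
    unfolding hermitian_inner_sum_left
    by (intro sum.cong refl)
      (auto intro: skew_hermitian_eigenvectors_orthogonal[OF assms(1) assms(3) assms(4)])
  then show ?thesis using assms(2) by simp
qed

lemma eigenvector_sum_eq_0:
  assumes "skew_hermitian A" and "finite S" and "\<And>\<theta>. \<theta> \<in> S \<Longrightarrow> A *v f \<theta> = \<theta> *s f \<theta>"
    and "(\<Sum>\<theta>\<in>S. f \<theta>) = 0" and "\<mu> \<in> S"
  shows "f \<mu> = 0"
  using hermitian_inner_eigenvector_sum[OF assms(1-3), of "f \<mu>" \<mu>] assms(3-5) by simp

lemma orthogonal_projection_eigenspace:
  assumes A: "skew_hermitian A" and S: "finite S" and f: "\<And>\<theta>. A *v f \<theta> = \<theta> *s f \<theta>"
  shows "orthogonal_projection (eigenspace A \<mu>) (\<Sum>\<theta>\<in>S. f \<theta>) = (if \<mu> \<in> S then f \<mu> else 0)"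
    (is "_ = ?w")
  unfolding orthogonal_projection_def
proof (rule the_equality)
  have w: "A *v ?w = \<mu> *s ?w" using f by simp
  have orth: "hermitian_inner ((\<Sum>\<theta>\<in>S. f \<theta>) - ?w) u = 0" if "A *v u = \<mu> *s u" for u
    using hermitian_inner_eigenvector_sum[OF A S f that] by (simp add: hermitian_inner_diff_left)
  show "?w \<in> eigenspace A \<mu> \<and> (\<forall>u\<in>eigenspace A \<mu>. hermitian_inner ((\<Sum>\<theta>\<in>S. f \<theta>) - ?w) u = 0)"
    using w orth by (simp add: eigenspace_def)
  fix z assume z: "z \<in> eigenspace A \<mu> \<and> (\<forall>u\<in>eigenspace A \<mu>. hermitian_inner ((\<Sum>\<theta>\<in>S. f \<theta>) - z) u = 0)"
  have e: "A *v (z - ?w) = \<mu> *s (z - ?w)"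
    using w z by (simp add: eigenspace_def vec.diff vec.scale_right_diff_distrib)
  then have "hermitian_inner ((\<Sum>\<theta>\<in>S. f \<theta>) - z) (z - ?w) = 0"
    using z by (simp add: eigenspace_def)
  with orth[OF e] have "hermitian_inner (z - ?w) (z - ?w) = 0"
    by (simp only: hermitian_inner_diff_left) simp
  then show "z = ?w" by simp
qed

lemma adj_matrix_in_Ints: "adj_matrix D $ i $ j \<in> \<int>"
  by (simp add: adj_matrix_def)

lemma skew_hermitian_adj_matrix:
  assumes "oriented_graph D"
  shows "skew_hermitian (adj_matrix D)"
  using assms by (auto simp: skew_hermitian_def adj_matrix_def oriented_graph_def)

lemma eigenvalue_support_decomposition:
  assumes "oriented_graph D"
  obtains f where "finite (eigenvalue_support D a)"
    and "\<And>\<theta>. adj_matrix D *v f \<theta> = \<theta> *s f \<theta>"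
    and "\<And>\<theta>. \<theta> \<in> eigenvalue_support D a \<Longrightarrow> f \<theta> \<noteq> 0"
    and "axis a 1 = (\<Sum>\<theta>\<in>eigenvalue_support D a. f \<theta>)"
proof -
  let ?A = "adj_matrix D"
  have A: "skew_hermitian ?A" using assms by (rule skew_hermitian_adj_matrix)
  obtain S f where S: "finite S" and f: "\<And>\<theta>. ?A *v f \<theta> = \<theta> *s f \<theta>"
    and sum: "axis a 1 = (\<Sum>\<theta>\<in>S. f \<theta>)"
    using skew_hermitian_eigenvector_decomposition[OF A, of "axis a 1"] by metis
  have "orthogonal_projection (eigenspace ?A \<mu>) (axis a 1) = (if \<mu> \<in> S then f \<mu> else 0)" for \<mu>
    unfolding sum by (rule orthogonal_projection_eigenspace[OF A S f])
  then have supp: "eigenvalue_support D a = {\<theta> \<in> S. f \<theta> \<noteq> 0}"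
    using f by (auto simp: eigenvalue_support_def eigenvalues_def)
  show thesis
  proof (rule that[of f])
    show "axis a 1 = (\<Sum>\<theta>\<in>eigenvalue_support D a. f \<theta>)"
      unfolding sum supp using S by (intro sum.mono_neutral_right) auto
  qed (use S f supp in auto)
qed

subsection \<open>The transition matrix and periodicity\<close>

lemma sums_vec:
  fixes X :: "nat \<Rightarrow> 'a::real_normed_vector ^ 'n"
  assumes "\<And>i. (\<lambda>k. X k $ i) sums (L $ i)"
  shows "X sums L"
  using assms unfolding sums_def by (intro vec_tendstoI) simp

lemma summable_vec:
  fixes X :: "nat \<Rightarrow> 'a::real_normed_vector ^ 'n"
  assumes "\<And>i. summable (\<lambda>k. X k $ i)"
  shows "summable X"
proof -
  have "X sums (\<chi> i. \<Sum>k. X k $ i)"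
    by (rule sums_vec) (simp add: assms summable_sums)
  then show ?thesis by (rule sums_summable)
qed

lemma mat_power_eigenvector:
  assumes "B *v v = \<theta> *s v"
  shows "mat_power B k *v v = \<theta> ^ k *s v"
  by (induction k)
    (simp_all add: matrix_vector_mul_assoc[symmetric] vec.scale assms mult.commute)

lemma summable_mat_exp:
  assumes "skew_hermitian B"
  shows "summable (\<lambda>k. (1 / fact k) *\<^sub>R mat_power B k)"
proof (intro summable_vec)
  fix i j
  obtain S f where S: "finite S" and f: "\<And>\<theta>. B *v f \<theta> = \<theta> *s f \<theta>"
    and sum: "axis j 1 = (\<Sum>\<theta>\<in>S. f \<theta>)"
    using skew_hermitian_eigenvector_decomposition[OF assms, of "axis j 1"] by metis
  have entry: "mat_power B k $ i $ j = (\<Sum>\<theta>\<in>S. \<theta> ^ k * f \<theta> $ i)" for k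
  proof -
    have "mat_power B k $ i $ j = (mat_power B k *v axis j 1) $ i"
      by (simp add: matrix_vector_mult_def axis_def if_distrib cong: if_cong)
    then show ?thesis
      by (simp add: sum vec.sum mat_power_eigenvector[OF f])
  qed
  have "summable (\<lambda>k. \<Sum>\<theta>\<in>S. (\<theta> ^ k /\<^sub>R fact k) * f \<theta> $ i)"
    by (intro summable_sum summable_mult2 summable_exp_generic)
  also have "(\<lambda>k. \<Sum>\<theta>\<in>S. (\<theta> ^ k /\<^sub>R fact k) * f \<theta> $ i) = (\<lambda>k. ((1 / fact k) *\<^sub>R mat_power B k) $ i $ j)"
    by (simp add: entry scaleR_sum_right divide_inverse)
  finally show "summable (\<lambda>k. ((1 / fact k) *\<^sub>R mat_power B k) $ i $ j)" .
qed

lemma matrix_scaleR_vector_mult: "(c *\<^sub>R B) *v v = complex_of_real c *s (B *v v)"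
  by (simp add: matrix_vector_mult_def vec_eq_iff sum_distrib_left scaleR_conv_of_real[where 'a = complex] mult.assoc)

lemma mat_exp_eigenvector:
  assumes B: "skew_hermitian B" and ev: "B *v v = \<theta> *s v"
  shows "mat_exp B *v v = exp \<theta> *s v"
proof -
  have "linear (\<lambda>M :: complex ^ 'a ^ 'a. M *v v)"
    by (rule linearI)
      (simp_all add: matrix_vector_mult_add_rdistrib matrix_scaleR_vector_mult vec_eq_iff
        scaleR_conv_of_real[where 'a = complex])
  then have "bounded_linear (\<lambda>M :: complex ^ 'a ^ 'a. M *v v)"
    by (simp add: linear_conv_bounded_linear)
  then have "(\<lambda>k. ((1 / fact k) *\<^sub>R mat_power B k) *v v) sums (mat_exp B *v v)"
    unfolding mat_exp_def by (rule bounded_linear.sums) (rule summable_sums[OF summable_mat_exp[OF B]])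
  moreover have "(\<lambda>k. ((1 / fact k) *\<^sub>R mat_power B k) *v v) sums (exp \<theta> *s v)"
  proof (rule sums_vec)
    fix i
    have "(\<lambda>k. (\<theta> ^ k /\<^sub>R fact k) * v $ i) sums (exp \<theta> * v $ i)"
      by (rule sums_mult2) (rule exp_converges)
    then show "(\<lambda>k. (((1 / fact k) *\<^sub>R mat_power B k) *v v) $ i) sums ((exp \<theta> *s v) $ i)"
      by (simp add: matrix_scaleR_vector_mult mat_power_eigenvector[OF ev] scaleR_conv_of_real[where 'a = complex]
          divide_inverse mult.assoc)
  qed
  ultimately show ?thesis by (rule sums_unique2)
qed

lemma transition_matrix_eigenvector:
  assumes "oriented_graph D" and "adj_matrix D *v v = \<theta> *s v"
  shows "transition_matrix D t *v v = exp (of_real t * \<theta>) *s v"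
  unfolding transition_matrix_def
proof (rule mat_exp_eigenvector)
  show "skew_hermitian (t *\<^sub>R adj_matrix D)"
    unfolding skew_hermitian_def
  proof (intro allI)
    fix i j
    have "adj_matrix D $ i $ j = - cnj (adj_matrix D $ j $ i)"
      using skew_hermitian_adj_matrix[OF assms(1)] unfolding skew_hermitian_def by blast
    then show "(t *\<^sub>R adj_matrix D) $ i $ j = - cnj ((t *\<^sub>R adj_matrix D) $ j $ i)" by simp
  qed
qed (simp add: matrix_scaleR_vector_mult assms(2))

lemma periodic_vertex_iff:
  assumes D: "oriented_graph D"
  shows "periodic_vertex D a \<longleftrightarrow>
    (\<exists>\<sigma>. \<sigma> \<noteq> 0 \<and> (\<exists>\<epsilon>\<in>{1, -1}. \<forall>\<theta>\<in>eigenvalue_support D a. exp (of_real \<sigma> * \<theta>) = \<epsilon>))"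
proof -
  let ?\<Phi> = "eigenvalue_support D a"
  obtain f where fin: "finite ?\<Phi>" and f: "\<And>\<theta>. adj_matrix D *v f \<theta> = \<theta> *s f \<theta>"
    and nz: "\<And>\<theta>. \<theta> \<in> ?\<Phi> \<Longrightarrow> f \<theta> \<noteq> 0" and sum: "axis a 1 = (\<Sum>\<theta>\<in>?\<Phi>. f \<theta>)"
    using eigenvalue_support_decomposition[OF D, of a] by metis
  have U: "transition_matrix D \<sigma> *v axis a 1 = \<epsilon> *s axis a 1 \<longleftrightarrow>
      (\<forall>\<theta>\<in>?\<Phi>. exp (of_real \<sigma> * \<theta>) = \<epsilon>)" for \<sigma> \<epsilon>
  proof -
    define g where "g \<theta> = (exp (of_real \<sigma> * \<theta>) - \<epsilon>) *s f \<theta>" for \<theta>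
    have "adj_matrix D *v (c *s f \<theta>) = \<theta> *s (c *s f \<theta>)" for c \<theta>
      by (simp add: vec.scale f mult.commute)
    then have g: "adj_matrix D *v g \<theta> = \<theta> *s g \<theta>" for \<theta> unfolding g_def .
    have diff: "transition_matrix D \<sigma> *v axis a 1 - \<epsilon> *s axis a 1 = (\<Sum>\<theta>\<in>?\<Phi>. g \<theta>)"
      by (simp add: sum vec.sum transition_matrix_eigenvector[OF D f] vec.scale_sum_right g_def
          vec.scale_left_diff_distrib sum_subtractf)
    show ?thesis
    proof
      assume "transition_matrix D \<sigma> *v axis a 1 = \<epsilon> *s axis a 1"
      with diff have "(\<Sum>\<theta>\<in>?\<Phi>. g \<theta>) = 0" by simp
      then have "g \<theta> = 0" if "\<theta> \<in> ?\<Phi>" for \<theta>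
        using eigenvector_sum_eq_0[OF skew_hermitian_adj_matrix[OF D] fin g _ that] by blast
      then show "\<forall>\<theta>\<in>?\<Phi>. exp (of_real \<sigma> * \<theta>) = \<epsilon>" using nz by (simp add: g_def)
    next
      assume "\<forall>\<theta>\<in>?\<Phi>. exp (of_real \<sigma> * \<theta>) = \<epsilon>"
      then have "(\<Sum>\<theta>\<in>?\<Phi>. g \<theta>) = 0" by (simp add: g_def)
      with diff show "transition_matrix D \<sigma> *v axis a 1 = \<epsilon> *s axis a 1" by simp
    qed
  qed
  show ?thesis
    unfolding periodic_vertex_def using U[of _ 1] U[of _ "-1"] by simp
qed

lemma eigenvalue_support_imaginary:
  assumes "oriented_graph D" and "\<theta> \<in> eigenvalue_support D a"
  shows "Re \<theta> = 0"
proof -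
  obtain v where "v \<noteq> 0" "adj_matrix D *v v = \<theta> *s v"
    using assms(2) by (auto simp: eigenvalue_support_def eigenvalues_def)
  then have "cnj \<theta> = - \<theta>"
    using skew_hermitian_eigenvalue[OF skew_hermitian_adj_matrix[OF assms(1)]] by blast
  then show ?thesis by (simp add: complex_eq_iff)
qed

lemma periodic_vertex_iff_ratios_rational:
  assumes D: "oriented_graph D"
  shows "periodic_vertex D a \<longleftrightarrow>
    (\<forall>\<theta>\<in>eigenvalue_support D a. \<forall>\<mu>\<in>eigenvalue_support D a. \<mu> \<noteq> 0 \<longrightarrow> \<theta> / \<mu> \<in> \<rat>)"
    (is "_ \<longleftrightarrow> ?R")
proof
  assume "periodic_vertex D a"
  then obtain \<sigma> \<epsilon> where \<sigma>: "\<sigma> \<noteq> 0" "\<epsilon> \<in> {1, -1}"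
      "\<And>\<theta>. \<theta> \<in> eigenvalue_support D a \<Longrightarrow> exp (of_real \<sigma> * \<theta>) = \<epsilon>"
    unfolding periodic_vertex_iff[OF D] by blast
  have int: "\<exists>n::int. of_real \<sigma> * \<theta> = \<i> * of_real pi * of_int n"
    if \<theta>: "\<theta> \<in> eigenvalue_support D a" for \<theta>
  proof -
    have "exp (2 * (of_real \<sigma> * \<theta>)) = 1"
      using \<sigma>(2) \<sigma>(3)[OF \<theta>] by (auto simp: exp_double)
    then obtain n :: int where "Im (2 * (of_real \<sigma> * \<theta>)) = of_int (2 * n) * pi"
      unfolding exp_eq_1 by blast
    then have "of_real \<sigma> * \<theta> = \<i> * of_real pi * of_int n"
      using eigenvalue_support_imaginary[OF D \<theta>] by (simp add: complex_eq_iff)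
    then show ?thesis ..
  qed
  show ?R
  proof (intro ballI impI)
    fix \<theta> \<mu> assume "\<theta> \<in> eigenvalue_support D a" "\<mu> \<in> eigenvalue_support D a" "\<mu> \<noteq> 0"
    then obtain n m :: int where nm: "of_real \<sigma> * \<theta> = \<i> * of_real pi * of_int n"
        "of_real \<sigma> * \<mu> = \<i> * of_real pi * of_int m"
      using int by blast
    have "\<theta> / \<mu> = (of_real \<sigma> * \<theta>) / (of_real \<sigma> * \<mu>)" using \<sigma>(1) by simp
    also have "\<dots> = of_int n / of_int m" unfolding nm by simp
    finally show "\<theta> / \<mu> \<in> \<rat>" by simp
  qed
next
  assume R: ?R
  show "periodic_vertex D a"
  proof (cases "\<exists>\<mu>\<in>eigenvalue_support D a. \<mu> \<noteq> 0")
    case False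
    then show ?thesis unfolding periodic_vertex_iff[OF D] by (intro exI[of _ 1]) auto
  next
    case True
    then obtain \<mu> where \<mu>: "\<mu> \<in> eigenvalue_support D a" "\<mu> \<noteq> 0" by blast
    have fin: "finite (eigenvalue_support D a)"
      using eigenvalue_support_decomposition[OF D] by metis
    obtain N :: int where N: "N > 0"
        "\<And>q. q \<in> (\<lambda>\<theta>. \<theta> / \<mu>) ` eigenvalue_support D a \<Longrightarrow> of_int N * q \<in> \<int>"
      using common_denominator[of "(\<lambda>\<theta>. \<theta> / \<mu>) ` eigenvalue_support D a"] fin R \<mu>
      by (metis (no_types, lifting) finite_imageI image_subsetI)
    define \<sigma> where "\<sigma> = 2 * pi * of_int N / Im \<mu>"
    have Re: "Re \<mu> = 0" by (rule eigenvalue_support_imaginary[OF D \<mu>(1)])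
    have Im: "Im \<mu> \<noteq> 0" using \<mu>(2) Re by (simp add: complex_eq_iff)
    have "exp (of_real \<sigma> * \<theta>) = 1" if \<theta>: "\<theta> \<in> eigenvalue_support D a" for \<theta>
    proof -
      obtain n :: int where n: "of_int N * (\<theta> / \<mu>) = of_int n"
        using N(2)[OF imageI[OF \<theta>]] by (rule Ints_cases)
      have "of_real \<sigma> * \<mu> = 2 * of_real pi * \<i> * of_int N"
        using Re Im by (simp add: complex_eq_iff \<sigma>_def)
      then have "of_real \<sigma> * \<theta> = 2 * of_real pi * \<i> * (of_int N * (\<theta> / \<mu>))"
        using \<mu>(2) by (simp add: field_simps)
      also have "\<dots> = \<i> * of_real (of_int (2 * n) * pi)" unfolding n by simp
      finally show ?thesis by (auto simp: exp_eq_1)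
    qed
    moreover have "\<sigma> \<noteq> 0" using N(1) Im by (simp add: \<sigma>_def)
    ultimately show ?thesis unfolding periodic_vertex_iff[OF D] by blast
  qed
qed

subsection \<open>Integrality of the eigenvalue support\<close>

lemma coeff_linear_factor_mult:
  fixes p :: "'a::comm_ring_1 poly"
  shows "coeff ([:-\<theta>, 1:] * p) (Suc k) = coeff p k - \<theta> * coeff p (Suc k)"
  by simp

lemma degree_prod_linear_factors:
  fixes S :: "'a::idom set"
  shows "degree (\<Prod>\<theta>\<in>S. [:-\<theta>, 1:]) = card S" and "lead_coeff (\<Prod>\<theta>\<in>S. [:-\<theta>, 1:]) = 1"
proof -
  show "degree (\<Prod>\<theta>\<in>S. [:-\<theta>, 1:]) = card S" by (subst degree_prod_eq_sum_degree) auto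
  show "lead_coeff (\<Prod>\<theta>\<in>S. [:-\<theta>, 1:]) = 1" by (simp add: lead_coeff_prod)
qed

text \<open>The factor $x^2$ makes the coefficients $e_1$ and $e_2$ available without a case
  distinction on the size of \<open>S\<close>.\<close>
lemma sum_squares_roots:
  fixes S :: "'a::idom set"
  assumes "finite S"
  defines "p \<equiv> monom 1 2 * (\<Prod>\<theta>\<in>S. [:-\<theta>, 1:])"
  shows "(\<Sum>\<theta>\<in>S. \<theta>\<^sup>2) = (coeff p (card S + 1))\<^sup>2 - 2 * coeff p (card S)"
  using assms(1) unfolding p_def
proof (induction S rule: finite_induct)
  case empty
  then show ?case by simp
next
  case (insert x S)
  let ?p = "monom 1 2 * (\<Prod>\<theta>\<in>S. [:-\<theta>, 1:])"
  have p: "monom 1 2 * (\<Prod>\<theta>\<in>insert x S. [:-\<theta>, 1:]) = [:-x, 1:] * ?p"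
    by (simp only: prod.insert[OF insert.hyps] mult.left_commute)
  have lead: "coeff ?p (card S + 2) = 1"
    using degree_prod_linear_factors[of S] by (simp add: coeff_monom_mult)
  have c1: "coeff ([:-x, 1:] * ?p) (card (insert x S) + 1) = coeff ?p (card S + 1) - x"
    using coeff_linear_factor_mult[of x ?p "card S + 1"] lead insert.hyps by simp
  have c0: "coeff ([:-x, 1:] * ?p) (card (insert x S)) = coeff ?p (card S) - x * coeff ?p (card S + 1)"
    using coeff_linear_factor_mult[of x ?p "card S"] insert.hyps by simp
  show ?case
    unfolding p c1 c0 using insert.IH insert.hyps by (simp add: power2_eq_square algebra_simps)
qed

lemma annihilator_coeffs_rational:
  fixes A :: "complex ^ 'n ^ 'n::finite"
  assumes A: "skew_hermitian A" and int_A: "\<And>i j. A $ i $ j \<in> \<int>" and int_v: "\<And>i. v $ i \<in> \<int>"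
    and S: "finite S" and f: "\<And>\<theta>. \<theta> \<in> S \<Longrightarrow> A *v f \<theta> = \<theta> *s f \<theta>"
    and nz: "\<And>\<theta>. \<theta> \<in> S \<Longrightarrow> f \<theta> \<noteq> 0" and v: "v = (\<Sum>\<theta>\<in>S. f \<theta>)"
  shows "coeff (\<Prod>\<theta>\<in>S. [:-\<theta>, 1:]) k \<in> \<rat>"
proof -
  define P where "P = (\<Prod>\<theta>\<in>S. [:-\<theta>, 1:])"
  have degP: "degree P = card S" and leadP: "coeff P (card S) = 1"
    using degree_prod_linear_factors[of S] by (simp_all add: P_def)
  have rootP: "poly P \<theta> = 0" if "\<theta> \<in> S" for \<theta>
    unfolding P_def poly_prod using S that by (intro prod_zero) auto
  obtain \<pi> :: "complex \<Rightarrow> complex"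
    where \<pi>: "\<And>x y. \<pi> (x + y) = \<pi> x + \<pi> y" "\<And>q z. q \<in> \<rat> \<Longrightarrow> \<pi> (q * z) = q * \<pi> z"
      "\<And>z. \<pi> z \<in> \<rat>" "\<pi> 1 = 1"
    using exists_rational_functional by blast
  have \<pi>0: "\<pi> 0 = 0" using \<pi>(2)[of 0 0] by simp
  have eval: "poly_apply A p v = (\<Sum>\<theta>\<in>S. poly p \<theta> *s f \<theta>)" for p
    unfolding v poly_apply_sum_vector by (intro sum.cong refl poly_apply_eigenvector f)
  define Q where "Q = map_poly \<pi> P"
  have coeffQ: "coeff Q k = \<pi> (coeff P k)" for k by (simp add: Q_def coeff_map_poly \<pi>0)
  have degQ: "degree Q \<le> card S" unfolding Q_def degP[symmetric] by (rule map_poly_degree_leq)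
  have int: "(mat_power A k *v v) $ i \<in> \<int>" for k i
    by (induction k arbitrary: i)
      (simp_all add: int_v matrix_vector_mul_assoc[symmetric] matrix_vector_mult_in_Ints int_A)
  have "poly_apply A Q v $ i = 0" for i
  proof -
    have "poly_apply A Q v $ i = (\<Sum>k\<le>card S. \<pi> (coeff P k) * (mat_power A k *v v) $ i)"
      by (simp add: poly_apply_upto[OF degQ] coeffQ)
    also have "\<dots> = (\<Sum>k\<le>card S. \<pi> (coeff P k * (mat_power A k *v v) $ i))"
    proof (intro sum.cong refl)
      fix k
      have "(mat_power A k *v v) $ i \<in> \<rat>" using int Ints_subset_Rats by blast
      then show "\<pi> (coeff P k) * (mat_power A k *v v) $ i = \<pi> (coeff P k * (mat_power A k *v v) $ i)"
        using \<pi>(2)[of "(mat_power A k *v v) $ i" "coeff P k"] by (simp add: mult.commute)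
    qed
    also have "\<dots> = \<pi> (poly_apply A P v $ i)"
      by (simp add: poly_apply_def degP additive_sum[of \<pi>, OF \<pi>(1)])
    also have "\<dots> = 0" by (simp add: eval rootP \<pi>0)
    finally show ?thesis .
  qed
  then have sum: "(\<Sum>\<theta>\<in>S. poly Q \<theta> *s f \<theta>) = 0"
    unfolding eval[symmetric] by (simp add: vec_eq_iff)
  have "A *v (poly Q \<theta> *s f \<theta>) = \<theta> *s (poly Q \<theta> *s f \<theta>)" if "\<theta> \<in> S" for \<theta>
    unfolding vec.scale f[OF that] by (simp add: mult.commute)
  then have "poly Q \<theta> *s f \<theta> = 0" if "\<theta> \<in> S" for \<theta>
    using eigenvector_sum_eq_0[OF A S, of "\<lambda>\<theta>. poly Q \<theta> *s f \<theta>"] sum that by blast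
  then have rootQ: "poly Q \<theta> = 0" if "\<theta> \<in> S" for \<theta> using nz that by simp
  have "Q = P"
    by (rule poly_eqI_degree_lead_coeff[of _ "card S" _ S])
      (use degQ degP rootP rootQ in \<open>simp_all add: coeffQ leadP \<pi>(4)\<close>)
  then show ?thesis using coeffQ[of k] \<pi>(3) unfolding P_def by metis
qed

lemma eigenvalue_support_sum_squares_rational:
  assumes D: "oriented_graph D"
  shows "(\<Sum>\<theta>\<in>eigenvalue_support D a. \<theta>\<^sup>2) \<in> \<rat>"
proof -
  obtain f where fin: "finite (eigenvalue_support D a)"
    and f: "\<And>\<theta>. adj_matrix D *v f \<theta> = \<theta> *s f \<theta>"
    and nz: "\<And>\<theta>. \<theta> \<in> eigenvalue_support D a \<Longrightarrow> f \<theta> \<noteq> 0"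
    and sum: "axis a 1 = (\<Sum>\<theta>\<in>eigenvalue_support D a. f \<theta>)"
    using eigenvalue_support_decomposition[OF D, of a] by metis
  have "coeff (\<Prod>\<theta>\<in>eigenvalue_support D a. [:-\<theta>, 1:]) k \<in> \<rat>" for k
    by (rule annihilator_coeffs_rational[OF skew_hermitian_adj_matrix[OF D] adj_matrix_in_Ints _ fin f nz sum])
      (simp add: axis_def)
  then show ?thesis
    unfolding sum_squares_roots[OF fin] by (simp add: coeff_monom_mult)
qed

lemma eigenvalue_support_square_in_Ints:
  assumes D: "oriented_graph D" and \<mu>: "\<mu> \<in> eigenvalue_support D a"
    and ratio: "\<And>\<theta>. \<theta> \<in> eigenvalue_support D a \<Longrightarrow> \<theta> / \<mu> \<in> \<rat>"
  shows "\<mu>\<^sup>2 \<in> \<int>"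
proof (cases "\<mu> = 0")
  case False
  let ?\<Phi> = "eigenvalue_support D a"
  have fin: "finite ?\<Phi>" using eigenvalue_support_decomposition[OF D] by metis
  have "\<exists>q. \<forall>\<theta>\<in>?\<Phi>. \<theta> = of_rat (q \<theta>) * \<mu>"
  proof (rule bchoice, rule ballI)
    fix \<theta> assume "\<theta> \<in> ?\<Phi>"
    then obtain r where "\<theta> / \<mu> = of_rat r" using ratio by (metis Rats_cases)
    then show "\<exists>r. \<theta> = of_rat r * \<mu>" using False by (metis nonzero_divide_eq_eq)
  qed
  then obtain q where q: "\<And>\<theta>. \<theta> \<in> ?\<Phi> \<Longrightarrow> \<theta> = of_rat (q \<theta>) * \<mu>" by blast
  define s where "s = (\<Sum>\<theta>\<in>?\<Phi>. (q \<theta>)\<^sup>2)"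
  have "q \<mu> = 1" using q[OF \<mu>] False by simp
  then have "s \<noteq> 0"
    using fin \<mu> by (auto simp: s_def sum_nonneg_eq_0_iff intro!: bexI[of _ \<mu>])
  have "(\<Sum>\<theta>\<in>?\<Phi>. \<theta>\<^sup>2) = (\<Sum>\<theta>\<in>?\<Phi>. (of_rat (q \<theta>) * \<mu>)\<^sup>2)"
    by (intro sum.cong refl arg_cong[of _ _ "\<lambda>x. x\<^sup>2"] q)
  also have "\<dots> = of_rat s * \<mu>\<^sup>2"
    by (simp add: s_def of_rat_sum of_rat_power power_mult_distrib sum_distrib_right)
  finally have "\<mu>\<^sup>2 = (\<Sum>\<theta>\<in>?\<Phi>. \<theta>\<^sup>2) / of_rat s" using \<open>s \<noteq> 0\<close> by simp
  then have rat: "\<mu>\<^sup>2 \<in> \<rat>" using eigenvalue_support_sum_squares_rational[OF D, of a] by simp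
  obtain v where v: "v \<noteq> 0" "adj_matrix D *v v = \<mu> *s v"
    using \<mu> by (auto simp: eigenvalue_support_def eigenvalues_def)
  show ?thesis
  proof (rule rational_eigenvalue_of_integer_matrix[OF _ rat v(1)])
    show "(adj_matrix D ** adj_matrix D) $ i $ j \<in> \<int>" for i j
      by (auto simp: matrix_matrix_mult_def intro!: Ints_sum Ints_mult adj_matrix_in_Ints)
    show "(adj_matrix D ** adj_matrix D) *v v = \<mu>\<^sup>2 *s v"
      by (simp add: matrix_vector_mul_assoc[symmetric] v(2) vec.scale power2_eq_square)
  qed
qed simp

lemma rational_in_Ints_if_squarefree_mult_square_in_Ints:
  fixes q :: "'a::field_char_0"
  assumes "q \<in> \<rat>" and "squarefree (\<Delta>::nat)" and "of_nat \<Delta> * q\<^sup>2 \<in> \<int>"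
  shows "q \<in> \<int>"
proof -
  obtain a b where ab: "b > 0" "coprime a b" "q = of_int a / of_int b"
    using assms(1) by (rule Rats_cases')
  obtain n where n: "of_nat \<Delta> * q\<^sup>2 = of_int n" using assms(3) by (auto elim: Ints_cases)
  have "(of_int (int \<Delta> * a\<^sup>2) :: 'a) = of_int (n * b\<^sup>2)"
    using n ab by (simp add: field_simps)
  then have "int \<Delta> * a\<^sup>2 = n * b\<^sup>2" by (simp only: of_int_eq_iff)
  then have "b\<^sup>2 dvd int \<Delta> * a\<^sup>2" by simp
  moreover have "coprime (b\<^sup>2) (a\<^sup>2)" using ab(2) by (simp add: coprime_commute)
  ultimately have "b\<^sup>2 dvd int \<Delta>" by (simp add: coprime_dvd_mult_left_iff)
  then have "int ((nat b)\<^sup>2) dvd int \<Delta>" using ab(1) by simp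
  then have "(nat b)\<^sup>2 dvd \<Delta>" by (simp only: int_dvd_int_iff)
  with assms(2) have "nat b = 1" by (auto dest: squarefreeD)
  then have "b = 1" by simp
  with ab show ?thesis by simp
qed

lemma csqrt_minus_of_nat: "csqrt (- of_nat n) = \<i> * of_real (sqrt (real n))"
  by (rule csqrt_unique) (simp_all add: power_mult_distrib flip: of_real_power)

lemma ratios_rational_if_support_in_Z_sqrt_neg:
  assumes D: "oriented_graph D" and sub: "eigenvalue_support D a \<subseteq> Z_sqrt_neg \<Delta>"
    and "\<theta> \<in> eigenvalue_support D a" and "\<mu> \<in> eigenvalue_support D a"
  shows "\<theta> / \<mu> \<in> \<rat>"
proof -
  let ?w = "\<i> * complex_of_real (sqrt (real \<Delta>))"
  have mult: "\<exists>y::int. \<theta> = of_int y * ?w" if \<theta>: "\<theta> \<in> eigenvalue_support D a" for \<theta>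
  proof -
    obtain x y :: int where xy: "\<theta> = of_int x + of_int y * ?w"
      using \<theta> sub unfolding Z_sqrt_neg_def csqrt_minus_of_nat by blast
    with eigenvalue_support_imaginary[OF D \<theta>] have "x = 0" by simp
    with xy show ?thesis by auto
  qed
  obtain y z :: int where "\<theta> = of_int y * ?w" "\<mu> = of_int z * ?w"
    using mult assms(3,4) by blast
  then show ?thesis by (cases "?w = 0") simp_all
qed

lemma support_in_Z_sqrt_neg_if_ratios_rational:
  assumes D: "oriented_graph D"
    and ratio: "\<And>\<theta> \<mu>. \<theta> \<in> eigenvalue_support D a \<Longrightarrow> \<mu> \<in> eigenvalue_support D a \<Longrightarrow> \<mu> \<noteq> 0 \<Longrightarrow> \<theta> / \<mu> \<in> \<rat>"
  shows "\<exists>\<Delta>::nat. \<Delta> > 0 \<and> squarefree \<Delta> \<and> eigenvalue_support D a \<subseteq> Z_sqrt_neg \<Delta>"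
proof (cases "\<exists>\<mu>\<in>eigenvalue_support D a. \<mu> \<noteq> 0")
  case False
  have "0 \<in> Z_sqrt_neg 1"
    unfolding Z_sqrt_neg_def by (intro CollectI exI[of _ 0]) simp
  with False show ?thesis by (intro exI[of _ 1]) auto
next
  case True
  then obtain \<mu> where \<mu>: "\<mu> \<in> eigenvalue_support D a" "\<mu> \<noteq> 0" by blast
  have square: "\<theta>\<^sup>2 \<in> \<int>" if "\<theta> \<in> eigenvalue_support D a" for \<theta>
    using eigenvalue_support_square_in_Ints[OF D that] ratio[OF _ that] by (cases "\<theta> = 0") auto
  have Re: "Re \<mu> = 0" by (rule eigenvalue_support_imaginary[OF D \<mu>(1)])
  obtain m :: int where "\<mu>\<^sup>2 = of_int m" using square[OF \<mu>(1)] by (auto elim: Ints_cases)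
  then have "Re (\<mu>\<^sup>2) = of_int m" by simp
  then have m: "(Im \<mu>)\<^sup>2 = of_int (- m)" using Re by (simp add: power2_eq_square)
  then have "m \<le> 0" by (metis neg_0_le_iff_le of_int_0_le_iff zero_le_power2)
  define n where "n = nat (- m)"
  have Im: "(Im \<mu>)\<^sup>2 = real n" using m \<open>m \<le> 0\<close> by (simp add: n_def)
  define \<Delta> where "\<Delta> = squarefree_part n"
  define s where "s = square_part n"
  have n: "n = \<Delta> * s\<^sup>2" unfolding \<Delta>_def s_def by (rule squarefree_decompose)
  have "Im \<mu> \<noteq> 0" using \<mu>(2) Re by (simp add: complex_eq_iff)
  then have "n \<noteq> 0" using Im by (metis of_nat_0 zero_eq_power2)
  have sf: "squarefree \<Delta>" unfolding \<Delta>_def by simp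
  have pos: "\<Delta> > 0" using \<open>n \<noteq> 0\<close> n by (intro gr0I) auto
  let ?w = "\<i> * complex_of_real (sqrt (real \<Delta>))"
  have "(Im \<mu>)\<^sup>2 = (real s * sqrt (real \<Delta>))\<^sup>2"
    by (simp add: Im n power_mult_distrib)
  then have "Im \<mu> = real s * sqrt (real \<Delta>) \<or> Im \<mu> = - (real s * sqrt (real \<Delta>))"
    by (simp only: power2_eq_iff)
  then obtain y :: int where "Im \<mu> = of_int y * sqrt (real \<Delta>)"
    by (metis mult_minus_left of_int_minus of_int_of_nat_eq)
  then have y: "\<mu> = of_int y * ?w" using Re by (simp add: complex_eq_iff)
  have "\<theta> \<in> Z_sqrt_neg \<Delta>" if \<theta>: "\<theta> \<in> eigenvalue_support D a" for \<theta>
  proof -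
    define q where "q = \<theta> / \<mu> * of_int y"
    have q: "q \<in> \<rat>" unfolding q_def using ratio[OF \<theta> \<mu>] by (intro Rats_mult Rats_of_int)
    have "q * ?w = \<theta> / \<mu> * (of_int y * ?w)" by (simp only: q_def mult.assoc)
    then have \<theta>': "\<theta> = q * ?w" using \<mu>(2) by (simp flip: y)
    have "of_nat \<Delta> * q\<^sup>2 = - \<theta>\<^sup>2"
      by (simp add: \<theta>' power_mult_distrib flip: of_real_power)
    then have "of_nat \<Delta> * q\<^sup>2 \<in> \<int>" using square[OF \<theta>] by simp
    then have "q \<in> \<int>" by (rule rational_in_Ints_if_squarefree_mult_square_in_Ints[OF q sf])
    then obtain z :: int where "q = of_int z" by (auto elim: Ints_cases)
    then have "\<theta> = of_int 0 + of_int z * ?w" using \<theta>' by simp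
    then show ?thesis unfolding Z_sqrt_neg_def csqrt_minus_of_nat by blast
  qed
  with pos sf show ?thesis by blast
qed

theorem theorem6p1:
  fixes D :: "'n::finite \<Rightarrow> 'n \<Rightarrow> bool" and a :: 'n
  assumes "oriented_graph D" and "graph_connected D" and "CARD('n) \<ge> 2"
  shows "(periodic_vertex D a \<longleftrightarrow>
            (\<forall>\<theta>\<in>eigenvalue_support D a. \<forall>\<mu>\<in>eigenvalue_support D a.
               \<mu> \<noteq> 0 \<longrightarrow> \<theta> / \<mu> \<in> \<rat>)) \<and>
         (periodic_vertex D a \<longleftrightarrow>
            (\<exists>\<Delta>::nat. \<Delta> > 0 \<and> squarefree \<Delta> \<and>
               eigenvalue_support D a \<subseteq> Z_sqrt_neg \<Delta>))"
  using periodic_vertex_iff_ratios_rational[OF assms(1), of a]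
    support_in_Z_sqrt_neg_if_ratios_rational[OF assms(1), of a]
    ratios_rational_if_support_in_Z_sqrt_neg[OF assms(1), of a]
  by blast

end
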